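(* Let $K$ be a finite set, let $k(x,y)\ge 0$ ($x\ne y\in K$) be the transition rates of an irreducible Markov jump process $X_t$ on $K$ with backward generator $L$ and unique stationary distribution $\rho^s$. Let $f:K\to\mathbb{R}$ with $\sum_x\rho^s(x)f(x)=0$, and let $V:K\to\mathbb{R}$ be a solution of the Poisson equation $LV(x)+f(x)=0$ for all $x\in K$ (which is unique up to an additive constant). Then there is a constant $c\in\mathbb{R}$ such that for all $x\in K$ $$V(x)=-\sum_{z\in K}\rho^s(z)\,f(z)\,\tau(x,z)+c,$$ where $\tau(x,z)$ is the mean first-passage time to reach $z$ from $x$; the additive constant $c$ is fixed, if needed, by the condition $\sum_x\rho^s(x)V(x)=0$.
   Context: The backward generator acts on functions $h:K\to\mathbb{R}$ by $Lh(x)=\sum_y k(x,y)[h(y)-h(x)]$. Irreducibility means that the digraph with vertex set $K$ and arcs $(x,y)$ for $k(x,y)>0$ is strongly connected. The stationary distribution $\rho^s>0$ is the unique probability distribution with $\rho^sL=0$. The mean first-passage time is $\tau(x,z)=\langle\inf\{t\ge0: X_t=z\}\mid X_0=x\rangle$; equivalently, for each fixed $z$ it is the solution of $\sum_y k(x,y)[\tau(y,z)-\tau(x,z)]+1=0$ for $x\ne z$ with $\tau(z,z)=0$. *)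

theory Defs
  imports "HOL-Probability.Probability"
begin

text \<open>The finite state space K is a type of class \<open>finite\<close>. A rate function
  \<open>k\<close> is only meaningful off the diagonal; none of the notions below depends on \<open>k x x\<close>.\<close>

definition backward_generator :: "('k::finite \<Rightarrow> 'k \<Rightarrow> real) \<Rightarrow> ('k \<Rightarrow> real) \<Rightarrow> 'k \<Rightarrow> real" where
  "backward_generator k h x = (\<Sum>y\<in>UNIV. k x y * (h y - h x))"

definition irreducible_rates :: "('k::finite \<Rightarrow> 'k \<Rightarrow> real) \<Rightarrow> bool" where
  "irreducible_rates k \<longleftrightarrow> (\<forall>x y. (x, y) \<in> {(u, v). k u v > 0}\<^sup>*)"

text \<open>The entry of the matrix of L in row x and column y is L applied to the indicator
  of y, evaluated at x; thus the last conjunct is \<open>\<rho> L = 0\<close>. Under irreducibility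
  uniqueness and strict positivity of \<open>\<rho>\<close> are consequences.\<close>

definition stationary_distribution :: "('k::finite \<Rightarrow> 'k \<Rightarrow> real) \<Rightarrow> ('k \<Rightarrow> real) \<Rightarrow> bool" where
  "stationary_distribution k \<rho> \<longleftrightarrow>
     (\<forall>x. \<rho> x \<ge> 0) \<and> (\<Sum>x\<in>UNIV. \<rho> x) = 1 \<and>
     (\<forall>y. (\<Sum>x\<in>UNIV. \<rho> x * backward_generator k (indicat_real {y}) x) = 0)"

text \<open>The (x, y) entry of the matrix exponential \<open>exp (t L)\<close>.\<close>

definition transition_prob :: "('k::finite \<Rightarrow> 'k \<Rightarrow> real) \<Rightarrow> real \<Rightarrow> 'k \<Rightarrow> 'k \<Rightarrow> real" where
  "transition_prob k t x y =
     (\<Sum>n. t ^ n / fact n * (backward_generator k ^^ n) (indicat_real {y}) x)"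

text \<open>A time-homogeneous Markov process, indexed by times \<open>t \<ge> 0\<close>, with right-continuous
  paths in the discrete space K and transition semigroup \<open>exp (t L)\<close>; the Markov property is
  expressed through the finite-dimensional distributions. The initial law is arbitrary.\<close>

definition markov_jump_process ::
  "('k::finite \<Rightarrow> 'k \<Rightarrow> real) \<Rightarrow> 'w measure \<Rightarrow> (real \<Rightarrow> 'w \<Rightarrow> 'k) \<Rightarrow> bool" where
  "markov_jump_process k M X \<longleftrightarrow>
     prob_space M \<and>
     (\<forall>t\<ge>0. X t \<in> measurable M (count_space UNIV)) \<and>
     (\<forall>\<omega>\<in>space M. \<forall>t\<ge>0. eventually (\<lambda>s. X s \<omega> = X t \<omega>) (at_right t)) \<and>
     (\<forall>(n::nat) (t::nat \<Rightarrow> real) (s::nat \<Rightarrow> 'k).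
        t 0 = 0 \<longrightarrow> (\<forall>i<n. t i \<le> t (Suc i)) \<longrightarrow>
        measure M {\<omega> \<in> space M. \<forall>i\<le>n. X (t i) \<omega> = s i} =
          measure M {\<omega> \<in> space M. X 0 \<omega> = s 0} *
          (\<Prod>i<n. transition_prob k (t (Suc i) - t i) (s i) (s (Suc i))))"

text \<open>Valued in \<open>[0, \<infinity>]\<close>: it is \<open>\<infinity>\<close> if z is never visited.\<close>

definition first_passage_time :: "(real \<Rightarrow> 'w \<Rightarrow> 'k) \<Rightarrow> 'k \<Rightarrow> 'w \<Rightarrow> ennreal" where
  "first_passage_time X z \<omega> = (INF t\<in>{t. 0 \<le> t \<and> X t \<omega> = z}. ennreal t)"

text \<open>\<open>P x\<close> is the law of the process conditioned to start at x.\<close>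

definition mean_first_passage_time ::
  "('k \<Rightarrow> 'w measure) \<Rightarrow> (real \<Rightarrow> 'w \<Rightarrow> 'k) \<Rightarrow> 'k \<Rightarrow> 'k \<Rightarrow> ennreal" where
  "mean_first_passage_time P X x z = (\<integral>\<^sup>+ \<omega>. first_passage_time X z \<omega> \<partial>P x)"

end

theory Submission
  imports Defs
begin

text \<open>Subtracting two solutions of the Poisson equation gives a harmonic function, and irreducibility
  makes harmonic functions constant (\<open>harmonic_constant\<close>, by the minimum principle). It therefore suffices
  that the right-hand side of the formula solves the Poisson equation. For this, only the action of
  \<open>L\<close> on \<open>\<tau> (\<cdot>, z)\<close> matters: it is \<open>- 1\<close> off \<open>z\<close>, and stationarity then forces
  \<open>- 1 + 1 / \<rho> z\<close> at \<open>z\<close> (\<open>stationary_mass_hitting\<close>). In the sum weighted by \<open>\<rho> z * f z\<close> the constant parts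
  cancel because \<open>f\<close> is centred, and the point masses leave \<open>f\<close>.

  The remaining issue is that the passage time, defined from the paths of the process, has a finite mean that
  solves \<open>L g = - 1\<close> off \<open>z\<close>. The equation has a nonnegative solution \<open>g\<close> with \<open>g z = 0\<close> by linear algebra
  (\<open>hitting_equation_solvable\<close>), and the mean passage time is identified with this \<open>g\<close>. Observe the process at
  multiples of a small step \<open>h\<close>. Off \<open>z\<close>, the semigroup lowers \<open>g\<close> by \<open>h + o(h)\<close> per step
  (\<open>semigroup_difference_quotient\<close>), so a telescoping sum compares \<open>g\<close> with the mean number of steps times \<open>h\<close>,
  up to factors close to \<open>1\<close> (\<open>mean_grid_passage_time_sandwich\<close>). This proves finiteness and the value at once,
  from the finite-dimensional distributions. Right continuity of the paths then shows that the passage times on the dyadic grids decrease to the true one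
  (\<open>first_passage_time_dyadic\<close>).\<close>

section \<open>The generator and the hitting equation\<close>

lemma generator_linear:
  "backward_generator k (\<lambda>x. a * g x + b * h x) x = a * backward_generator k g x + b * backward_generator k h x"
  unfolding backward_generator_def sum_distrib_left sum.distrib[symmetric]
  by (intro sum.cong) (auto simp: algebra_simps)

lemma generator_sum:
  "backward_generator k (\<lambda>x. \<Sum>i\<in>I. c i * g i x) x = (\<Sum>i\<in>I. c i * backward_generator k (g i) x)"
proof -
  have "backward_generator k (\<lambda>x. \<Sum>i\<in>I. c i * g i x) x
      = (\<Sum>y\<in>UNIV. \<Sum>i\<in>I. c i * (k x y * (g i y - g i x)))"
    unfolding backward_generator_def sum_subtractf[symmetric] sum_distrib_left
    by (intro sum.cong refl) (simp add: right_diff_distrib mult_ac)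
  also have "\<dots> = (\<Sum>i\<in>I. c i * backward_generator k (g i) x)"
    unfolding backward_generator_def by (subst sum.swap) (simp add: sum_distrib_left)
  finally show ?thesis .
qed

lemma sum_indicator_basis:
  fixes g :: "'k::finite \<Rightarrow> real"
  shows "(\<Sum>y\<in>UNIV. g y * indicat_real {y} x) = g x"
  by (simp add: indicator_def if_distrib[of "\<lambda>a. _ * a"] eq_commute[of x] cong: if_cong)

lemma generator_matrix:
  "backward_generator k g x = (\<Sum>y\<in>UNIV. g y * backward_generator k (indicat_real {y}) x)"
  using sum_indicator_basis[of g] generator_sum[of k g "\<lambda>y. indicat_real {y}" UNIV x]
  by simp

lemma stationary_generator_zero:
  assumes "stationary_distribution k \<rho>"
  shows "(\<Sum>x\<in>UNIV. \<rho> x * backward_generator k g x) = 0"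
proof -
  have "(\<Sum>x\<in>UNIV. \<rho> x * backward_generator k g x)
      = (\<Sum>x\<in>UNIV. \<Sum>y\<in>UNIV. g y * (\<rho> x * backward_generator k (indicat_real {y}) x))"
    unfolding generator_matrix[of k g] sum_distrib_left
    by (intro sum.cong refl mult.left_commute)
  also have "\<dots> = (\<Sum>y\<in>UNIV. g y * (\<Sum>x\<in>UNIV. \<rho> x * backward_generator k (indicat_real {y}) x))"
    by (subst sum.swap) (simp add: sum_distrib_left)
  also have "\<dots> = 0"
    using assms by (simp add: stationary_distribution_def)
  finally show ?thesis .
qed

text \<open>At a minimiser other than \<open>z\<close> the sum defining \<open>L h\<close> has only nonnegative terms and is at
  most \<open>0\<close>, so every state reachable by one jump is again a minimiser. Following jumps from a
  minimiser to \<open>z\<close>, which irreducibility makes possible, transports minimality to \<open>z\<close>.\<close>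

lemma minimum_principle:
  fixes k :: "'k::finite \<Rightarrow> 'k \<Rightarrow> real"
  assumes nonneg: "\<And>x y. x \<noteq> y \<Longrightarrow> k x y \<ge> 0"
    and irr: "irreducible_rates k"
    and super: "\<And>x. x \<noteq> z \<Longrightarrow> backward_generator k h x \<le> 0"
  shows "h z \<le> h x"
proof -
  define m where "m = Min (range h)"
  have m_le: "m \<le> h y" for y
    unfolding m_def by simp
  have "m \<in> range h"
    unfolding m_def by (rule Min_in) auto
  then obtain a where a: "h a = m"
    by auto
  have "(a, z) \<in> {(u, v). k u v > 0}\<^sup>*"
    using irr by (simp add: irreducible_rates_def)
  then have "h z = m"
    using a
  proof (induction rule: converse_rtrancl_induct)
    case base
    then show ?case .
  next
    case (step u v)
    show ?case
    proof (cases "u = z")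
      case True
      then show ?thesis using step.prems by simp
    next
      case False
      have terms: "0 \<le> k u y * (h y - h u)" for y
        using nonneg[of u y] m_le[of y] step.prems by (cases "u = y") auto
      have "(\<Sum>y\<in>UNIV. k u y * (h y - h u)) = 0"
        using super[OF False] unfolding backward_generator_def
        by (intro order_antisym sum_nonneg terms)
      then have "k u v * (h v - h u) = 0"
        by (rule sum_nonneg_0[rotated 2]) (simp_all add: terms)
      then have "h v = m"
        using step.hyps(1) step.prems by simp
      then show ?thesis by (rule step.IH)
    qed
  qed
  then show ?thesis using m_le by simp
qed

lemma harmonic_constant:
  fixes k :: "'k::finite \<Rightarrow> 'k \<Rightarrow> real"
  assumes nonneg: "\<And>x y. x \<noteq> y \<Longrightarrow> k x y \<ge> 0"
    and irr: "irreducible_rates k"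
    and harm: "\<And>x. backward_generator k h x = 0"
  shows "h x = h y"
  by (rule order_antisym; rule minimum_principle[OF nonneg irr]) (simp_all add: harm)

text \<open>The hitting equation is a square linear system: one equation \<open>L g = - 1\<close> for each state
  off \<open>z\<close>, and \<open>g z = 0\<close> for the remaining one. The minimum principle, applied to a solution of the
  homogeneous system and to its negative, shows that the system is injective, hence solvable; applied
  to the solution it gives nonnegativity.\<close>

lemma hitting_equation_solvable:
  fixes k :: "'k::finite \<Rightarrow> 'k \<Rightarrow> real"
  assumes nonneg: "\<And>x y. x \<noteq> y \<Longrightarrow> k x y \<ge> 0"
    and irr: "irreducible_rates k"
  obtains g where "g z = 0" "\<And>x. 0 \<le> g x" "\<And>x. x \<noteq> z \<Longrightarrow> backward_generator k g x = -1"
proof -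
  define A :: "real^'k \<Rightarrow> real^'k"
    where "A h = (\<chi> x. if x = z then h $ z else backward_generator k (($) h) x)" for h
  have lin: "linear A"
  proof (rule linearI)
    fix h h' :: "real^'k" and c :: real
    have "($) (h + h') = (\<lambda>x. 1 * h $ x + 1 * h' $ x)"
      by auto
    then show "A (h + h') = A h + A h'"
      unfolding A_def vec_eq_iff by (simp only: generator_linear) simp
    have "($) (c *\<^sub>R h) = (\<lambda>x. c * h $ x + 0 * h $ x)"
      by auto
    then show "A (c *\<^sub>R h) = c *\<^sub>R A h"
      unfolding A_def vec_eq_iff by (simp only: generator_linear) simp
  qed
  have "h = 0" if "A h = 0" for h
  proof -
    have hx: "backward_generator k (($) h) x = 0" if "x \<noteq> z" for x
      using \<open>A h = 0\<close> that by (auto simp: A_def vec_eq_iff split: if_splits)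
    have hz: "h $ z = 0"
      using \<open>A h = 0\<close> by (auto simp: A_def vec_eq_iff split: if_splits)
    have "h $ z \<le> h $ x" for x
      using hx by (intro minimum_principle[OF nonneg irr]) auto
    moreover have "- (h $ z) \<le> - (h $ x)" for x
    proof (rule minimum_principle[OF nonneg irr, of z "\<lambda>x. - (h $ x)"])
      show "backward_generator k (\<lambda>x. - (h $ x)) y \<le> 0" if "y \<noteq> z" for y
        using generator_linear[of k "-1" "($) h" 0 "($) h" y] hx[OF that] by simp
    qed
    ultimately show "h = 0"
      using hz by (auto simp: vec_eq_iff intro: order_antisym)
  qed
  then have "inj A"
    using lin by (simp add: linear_injective_0)
  then have "surj A"
    using linear_injective_imp_surjective[OF lin] by simp
  then obtain h where h: "A h = (\<chi> x. if x = z then 0 else -1)"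
    by (metis surjD)
  have hz: "h $ z = 0"
    using h by (auto simp: A_def vec_eq_iff split: if_splits)
  have hx: "backward_generator k (($) h) x = -1" if "x \<noteq> z" for x
    using h that by (auto simp: A_def vec_eq_iff split: if_splits)
  have "0 \<le> h $ x" for x
    using minimum_principle[OF nonneg irr, of z "($) h" x] hx hz by simp
  then show ?thesis
    using that[of "($) h"] hz hx by blast
qed

section \<open>The semigroup for small times\<close>

text \<open>The exponential series of \<open>t L\<close> is dominated by a scalar exponential series, which is what
  allows differentiating it at \<open>t = 0\<close>.\<close>

lemma generator_power_bound:
  fixes k :: "'k::finite \<Rightarrow> 'k \<Rightarrow> real"
  assumes bound: "\<And>x. \<bar>h x\<bar> \<le> c"
  shows "\<bar>(backward_generator k ^^ n) h x\<bar> \<le> (2 * (\<Sum>u\<in>UNIV. \<Sum>v\<in>UNIV. \<bar>k u v\<bar>)) ^ n * c"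
proof (induction n arbitrary: x)
  case 0
  then show ?case using bound by simp
next
  case (Suc n)
  define S where "S = (\<Sum>u\<in>UNIV. \<Sum>v\<in>UNIV. \<bar>k u v\<bar>)"
  define H where "H = (backward_generator k ^^ n) h"
  define D where "D = (2 * S) ^ n * c"
  have H: "\<bar>H y\<bar> \<le> D" for y
    using Suc.IH unfolding H_def D_def S_def .
  then have D: "0 \<le> D"
    using abs_ge_zero order_trans by blast
  have "\<bar>backward_generator k H x\<bar> \<le> (\<Sum>y\<in>UNIV. \<bar>k x y\<bar> * (2 * D))"
    unfolding backward_generator_def
  proof (rule order_trans[OF sum_abs sum_mono])
    fix y
    have "\<bar>H y - H x\<bar> \<le> 2 * D"
      using H[of x] H[of y] by linarith
    then show "\<bar>k x y * (H y - H x)\<bar> \<le> \<bar>k x y\<bar> * (2 * D)"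
      by (simp add: abs_mult mult_left_mono)
  qed
  also have "\<dots> = (\<Sum>y\<in>UNIV. \<bar>k x y\<bar>) * (2 * D)"
    by (simp add: sum_distrib_right)
  also have "\<dots> \<le> S * (2 * D)"
    unfolding S_def using D
    by (intro mult_right_mono member_le_sum[of x UNIV "\<lambda>u. \<Sum>v\<in>UNIV. \<bar>k u v\<bar>"]) (auto intro: sum_nonneg)
  finally show ?case
    unfolding H_def D_def S_def by (simp add: mult_ac)
qed

lemma transition_prob_derivative:
  fixes k :: "'k::finite \<Rightarrow> 'k \<Rightarrow> real"
  shows "((\<lambda>t. transition_prob k t x y) has_real_derivative
     backward_generator k (indicat_real {y}) x) (at 0)"
proof -
  define a where "a n = (backward_generator k ^^ n) (indicat_real {y}) x / fact n" for n
  define C where "C = 2 * (\<Sum>u\<in>UNIV. \<Sum>v\<in>UNIV. \<bar>k u v\<bar>)"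
  have "norm (a n * 1 ^ n) \<le> inverse (fact n) * C ^ n" for n
  proof -
    have "\<bar>(backward_generator k ^^ n) (indicat_real {y}) x\<bar> \<le> C ^ n * 1"
      unfolding C_def by (rule generator_power_bound) (simp add: indicator_def)
    then have "\<bar>(backward_generator k ^^ n) (indicat_real {y}) x\<bar> / fact n \<le> C ^ n / fact n"
      by (intro divide_right_mono) simp_all
    then show ?thesis
      by (simp add: a_def field_simps)
  qed
  then have "summable (\<lambda>n. a n * 1 ^ n)"
    by (rule summable_comparison_test'[OF summable_exp, of 0])
  then have "((\<lambda>t. \<Sum>n. a n * t ^ n) has_real_derivative (\<Sum>n. diffs a n * 0 ^ n)) (at 0)"
    by (rule termdiffs_strong) simp
  moreover have "(\<lambda>t. \<Sum>n. a n * t ^ n) = (\<lambda>t. transition_prob k t x y)"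
    by (simp add: a_def transition_prob_def mult.commute)
  moreover have "(\<Sum>n. diffs a n * 0 ^ n) = backward_generator k (indicat_real {y}) x"
    by (simp only: powser_zero) (simp add: diffs_def a_def)
  ultimately show ?thesis by simp
qed

definition markov_operator :: "('k::finite \<Rightarrow> 'k \<Rightarrow> real) \<Rightarrow> real \<Rightarrow> ('k \<Rightarrow> real) \<Rightarrow> 'k \<Rightarrow> real" where
  "markov_operator k t g x = (\<Sum>y\<in>UNIV. transition_prob k t x y * g y)"

lemma transition_prob_zero: "transition_prob k 0 x y = indicat_real {y} x"
  using powser_zero[of "\<lambda>n. (backward_generator k ^^ n) (indicat_real {y}) x / fact n"]
  by (simp add: transition_prob_def mult.commute)

text \<open>This first-order expansion is the only link between the generator and the transition
  probabilities in what follows: one step of the sampled chain changes \<open>g\<close> by about \<open>h * L g\<close>.\<close>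

lemma semigroup_difference_quotient:
  fixes k :: "'k::finite \<Rightarrow> 'k \<Rightarrow> real"
  shows "((\<lambda>t. (markov_operator k t g x - g x) / t) \<longlongrightarrow> backward_generator k g x) (at 0)"
proof -
  have "((\<lambda>t. markov_operator k t g x) has_real_derivative
      (\<Sum>y\<in>UNIV. backward_generator k (indicat_real {y}) x * g y)) (at 0)"
    unfolding markov_operator_def
    by (intro DERIV_sum DERIV_cmult_right transition_prob_derivative)
  moreover have "markov_operator k 0 g x = g x"
    using sum_indicator_basis[of g x] by (simp add: markov_operator_def transition_prob_zero mult.commute)
  ultimately show ?thesis
    by (subst generator_matrix) (simp add: has_field_derivative_iff mult.commute)
qed

section \<open>Grid-sampled paths avoiding the target\<close>

lemma sum_PiE_insert:
  assumes "a \<notin> I"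
  shows "(\<Sum>s\<in>PiE (insert a I) T. F s) = (\<Sum>y\<in>T a. \<Sum>s\<in>PiE I T. F (s(a := y)))"
proof -
  have "(\<Sum>s\<in>PiE (insert a I) T. F s) = (\<Sum>(y, s)\<in>T a \<times> PiE I T. F (s(a := y)))"
    unfolding PiE_insert_eq using assms
    by (subst sum.reindex[OF inj_combinator]) (simp_all add: case_prod_unfold)
  then show ?thesis
    by (simp add: sum.cartesian_product)
qed

text \<open>Sampled at the times \<open>0, h, 2 h, \<dots>\<close>, the process is a Markov chain with transition
  operator \<open>exp (h L)\<close>. Everything needed about it is the expectation of a function of the state at
  step \<open>n\<close> on the event that the target \<open>z\<close> has not been seen up to that step. Writing it as a sum
  over finite paths makes the finite-dimensional distributions directly applicable.\<close>

definition grid_path ::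
    "'w measure \<Rightarrow> (real \<Rightarrow> 'w \<Rightarrow> 'k) \<Rightarrow> real \<Rightarrow> nat \<Rightarrow> (nat \<Rightarrow> 'k) \<Rightarrow> 'w set" where
  "grid_path M X h n s = {\<omega> \<in> space M. \<forall>i\<le>n. X (real i * h) \<omega> = s i}"

definition avoids ::
    "'w measure \<Rightarrow> (real \<Rightarrow> 'w \<Rightarrow> 'k) \<Rightarrow> 'k \<Rightarrow> real \<Rightarrow> nat \<Rightarrow> 'w set" where
  "avoids M X z h n = {\<omega> \<in> space M. \<forall>i\<le>n. X (real i * h) \<omega> \<noteq> z}"

definition avoiding_mean ::
    "'w measure \<Rightarrow> (real \<Rightarrow> 'w \<Rightarrow> 'k::finite) \<Rightarrow> 'k \<Rightarrow> real \<Rightarrow> nat \<Rightarrow> ('k \<Rightarrow> real) \<Rightarrow> real" where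
  "avoiding_mean M X z h n g =
     (\<Sum>s\<in>PiE {..n} (\<lambda>_. - {z}). measure M (grid_path M X h n s) * g (s n))"

lemma grid_path_sets:
  assumes "markov_jump_process k M X" "0 \<le> h"
  shows "grid_path M X h n s \<in> sets M"
proof -
  have [measurable]: "X (real i * h) \<in> measurable M (count_space UNIV)" for i
    using assms by (simp add: markov_jump_process_def)
  show ?thesis
    unfolding grid_path_def by measurable
qed

lemma avoids_sets:
  assumes "markov_jump_process k M X" "0 \<le> h"
  shows "avoids M X z h n \<in> sets M"
proof -
  have [measurable]: "X (real i * h) \<in> measurable M (count_space UNIV)" for i
    using assms by (simp add: markov_jump_process_def)
  show ?thesis
    unfolding avoids_def by measurable
qed

text \<open>The Markov property for one grid step, read off from the product formula by
  comparing \<open>n\<close> and \<open>n + 1\<close> steps.\<close>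

lemma measure_grid_path_Suc:
  assumes process: "markov_jump_process k M X" and h: "0 \<le> h"
  shows "measure M (grid_path M X h (Suc n) s) =
    measure M (grid_path M X h n s) * transition_prob k h (s n) (s (Suc n))"
proof -
  have product: "measure M (grid_path M X h m s) = measure M {\<omega> \<in> space M. X 0 \<omega> = s 0} *
      (\<Prod>i<m. transition_prob k h (s i) (s (Suc i)))" for m
  proof -
    have "measure M (grid_path M X h m s) = measure M {\<omega> \<in> space M. X 0 \<omega> = s 0} *
        (\<Prod>i<m. transition_prob k (real (Suc i) * h - real i * h) (s i) (s (Suc i)))"
      unfolding grid_path_def
      using process[unfolded markov_jump_process_def] h
      by (elim conjE allE[of _ m] allE[of _ "\<lambda>i. real i * h"] allE[of _ s])
        (simp_all add: mult_right_mono)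
    moreover have "real (Suc i) * h - real i * h = h" for i
      by (simp add: algebra_simps)
    ultimately show ?thesis by simp
  qed
  show ?thesis
    unfolding product by simp
qed

lemma measure_avoids:
  fixes X :: "real \<Rightarrow> 'w \<Rightarrow> 'k::finite"
  assumes process: "markov_jump_process k M X" and h: "0 \<le> h"
  shows "measure M (avoids M X z h n) = avoiding_mean M X z h n (\<lambda>_. 1)"
proof -
  interpret prob_space M
    using process by (simp add: markov_jump_process_def)
  let ?S = "PiE {..n} (\<lambda>_. - {z})"
  have "avoids M X z h n = (\<Union>s\<in>?S. grid_path M X h n s)"
  proof (intro subset_antisym subsetI)
    fix \<omega> assume \<omega>: "\<omega> \<in> avoids M X z h n"
    then have "restrict (\<lambda>i. X (real i * h) \<omega>) {..n} \<in> ?S"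
      by (auto simp: avoids_def)
    moreover have "\<omega> \<in> grid_path M X h n (restrict (\<lambda>i. X (real i * h) \<omega>) {..n})"
      using \<omega> by (auto simp: avoids_def grid_path_def)
    ultimately show "\<omega> \<in> (\<Union>s\<in>?S. grid_path M X h n s)"
      by blast
  next
    fix \<omega> assume "\<omega> \<in> (\<Union>s\<in>?S. grid_path M X h n s)"
    then show "\<omega> \<in> avoids M X z h n"
      by (auto simp: avoids_def grid_path_def PiE_def Pi_def)
  qed
  moreover have "disjoint_family_on (grid_path M X h n) ?S"
    unfolding disjoint_family_on_def
  proof (intro ballI impI)
    fix s s' assume s: "s \<in> ?S" "s' \<in> ?S" "s \<noteq> s'"
    have "s = s'" if "\<omega> \<in> grid_path M X h n s" "\<omega> \<in> grid_path M X h n s'" for \<omega>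
      using that by (intro PiE_ext[OF s(1,2)]) (simp add: grid_path_def)
    then show "grid_path M X h n s \<inter> grid_path M X h n s' = {}"
      using s(3) by blast
  qed
  ultimately show ?thesis
    using grid_path_sets[OF process h]
    by (simp add: avoiding_mean_def finite_measure_finite_Union finite_PiE image_subset_iff)
qed

lemma avoiding_mean_0:
  assumes "g z = 0"
  shows "avoiding_mean M X z h 0 g = (\<Sum>y\<in>UNIV. measure M {\<omega> \<in> space M. X 0 \<omega> = y} * g y)"
proof -
  have "avoiding_mean M X z h 0 g = (\<Sum>y\<in>- {z}. measure M {\<omega> \<in> space M. X 0 \<omega> = y} * g y)"
    unfolding avoiding_mean_def atMost_0
    by (subst sum_PiE_insert) (simp_all add: grid_path_def)
  also have "\<dots> = (\<Sum>y\<in>UNIV. measure M {\<omega> \<in> space M. X 0 \<omega> = y} * g y)"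
    using assms by (intro sum.mono_neutral_left) auto
  finally show ?thesis .
qed

text \<open>Because \<open>g\<close> vanishes at the target, summing the last step over all states instead
  of over those off \<open>z\<close> costs nothing. This is how the killed chain is expressed through the
  semigroup of the original one.\<close>

lemma avoiding_mean_Suc:
  assumes process: "markov_jump_process k M X" and h: "0 \<le> h" and "g z = 0"
  shows "avoiding_mean M X z h (Suc n) g = avoiding_mean M X z h n (markov_operator k h g)"
proof -
  let ?S = "PiE {..n} (\<lambda>_. - {z})"
  have prefix: "grid_path M X h n (s(Suc n := y)) = grid_path M X h n s" for s y
    by (auto simp: grid_path_def)
  have "avoiding_mean M X z h (Suc n) g = (\<Sum>y\<in>- {z}. \<Sum>s\<in>?S.
      measure M (grid_path M X h n s) * (transition_prob k h (s n) y * g y))"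
    unfolding avoiding_mean_def atMost_Suc
    by (subst sum_PiE_insert) (simp_all add: measure_grid_path_Suc[OF process h] prefix mult.assoc)
  also have "\<dots> = (\<Sum>y\<in>UNIV. \<Sum>s\<in>?S.
      measure M (grid_path M X h n s) * (transition_prob k h (s n) y * g y))"
    using \<open>g z = 0\<close> by (intro sum.mono_neutral_left) auto
  also have "\<dots> = avoiding_mean M X z h n (markov_operator k h g)"
    unfolding avoiding_mean_def markov_operator_def
    by (subst sum.swap) (simp add: sum_distrib_left)
  finally show ?thesis .
qed

lemma avoiding_mean_mono:
  assumes "\<And>x. x \<noteq> z \<Longrightarrow> f x \<le> g x"
  shows "avoiding_mean M X z h n f \<le> avoiding_mean M X z h n g"
  unfolding avoiding_mean_def
  by (intro sum_mono mult_left_mono assms) auto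

lemma avoiding_mean_diff:
  "avoiding_mean M X z h n f - avoiding_mean M X z h n g = avoiding_mean M X z h n (\<lambda>x. f x - g x)"
  by (simp add: avoiding_mean_def sum_subtractf right_diff_distrib)

lemma avoiding_mean_const:
  "avoiding_mean M X z h n (\<lambda>_. c) = c * avoiding_mean M X z h n (\<lambda>_. 1)"
  by (simp add: avoiding_mean_def sum_distrib_left mult.commute)

section \<open>Discretised passage times\<close>

definition grid_passage_time :: "(real \<Rightarrow> 'w \<Rightarrow> 'k) \<Rightarrow> 'k \<Rightarrow> real \<Rightarrow> 'w \<Rightarrow> ennreal" where
  "grid_passage_time X z h \<omega> = (INF n\<in>{n. X (real n * h) \<omega> = z}. ennreal (real n * h))"

text \<open>The layer-cake form of the passage time: each step survived contributes \<open>h\<close>. It gives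
  measurability and turns the mean into a series of avoidance probabilities.\<close>

lemma grid_passage_time_series:
  assumes h: "0 < h" and \<omega>: "\<omega> \<in> space M"
  shows "grid_passage_time X z h \<omega> = (\<Sum>n. ennreal h * indicator (avoids M X z h n) \<omega>)"
proof (cases "\<exists>n. X (real n * h) \<omega> = z")
  case True
  define N where "N = (LEAST n. X (real n * h) \<omega> = z)"
  have N: "X (real N * h) \<omega> = z"
    unfolding N_def using True by (rule LeastI_ex)
  have N_le: "N \<le> n" if "X (real n * h) \<omega> = z" for n
    unfolding N_def using that by (rule Least_le)
  have avoid: "\<omega> \<in> avoids M X z h n \<longleftrightarrow> n < N" for n
  proof -
    have "(\<forall>i\<le>n. X (real i * h) \<omega> \<noteq> z) \<longleftrightarrow> n < N"
    proof
      assume "\<forall>i\<le>n. X (real i * h) \<omega> \<noteq> z"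
      then show "n < N" using N by (metis not_le)
    next
      assume "n < N"
      then show "\<forall>i\<le>n. X (real i * h) \<omega> \<noteq> z" using N_le by fastforce
    qed
    then show ?thesis
      using \<omega> by (simp add: avoids_def)
  qed
  have "grid_passage_time X z h \<omega> = ennreal (real N * h)"
    unfolding grid_passage_time_def using N h
    by (intro antisym INF_lower INF_greatest)
      (auto intro!: ennreal_leI mult_right_mono N_le)
  also have "\<dots> = (\<Sum>n<N. ennreal h * indicator (avoids M X z h n) \<omega>)"
    using h by (simp add: avoid indicator_def ennreal_mult ennreal_of_nat_eq_real_of_nat)
  also have "\<dots> = (\<Sum>n. ennreal h * indicator (avoids M X z h n) \<omega>)"
    by (rule suminf_finite[symmetric]) (auto simp: avoid indicator_def)
  finally show ?thesis .
next
  case False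
  then have "\<omega> \<in> avoids M X z h n" for n
    using \<omega> by (simp add: avoids_def)
  then have "(\<Sum>n. ennreal h * indicator (avoids M X z h n) \<omega>) = (\<Sum>n::nat. ennreal h)"
    by simp
  also have "\<dots> = \<top>"
  proof (rule ccontr)
    assume "(\<Sum>n::nat. ennreal h) \<noteq> \<top>"
    then have "summable (\<lambda>n::nat. h)"
      using h by (intro summable_suminf_not_top) simp_all
    then show False
      using h by (simp add: summable_const_iff)
  qed
  finally show ?thesis
    using False by (simp add: grid_passage_time_def)
qed

text \<open>By right continuity a visit at time \<open>t\<close> lasts for a positive time, so every fine enough
  grid has a point in it just after \<open>t\<close>.\<close>

lemma first_passage_time_dyadic:
  assumes process: "markov_jump_process k M X" and \<omega>: "\<omega> \<in> space M"
  shows "first_passage_time X z \<omega> = (INF m. grid_passage_time X z ((1/2) ^ m) \<omega>)"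
proof (rule antisym)
  show "first_passage_time X z \<omega> \<le> (INF m. grid_passage_time X z ((1/2) ^ m) \<omega>)"
    unfolding grid_passage_time_def first_passage_time_def
    by (intro INF_greatest INF_lower) auto
next
  show "(INF m. grid_passage_time X z ((1/2) ^ m) \<omega>) \<le> first_passage_time X z \<omega>"
    unfolding first_passage_time_def
  proof (rule INF_greatest)
    fix t assume t: "t \<in> {t. 0 \<le> t \<and> X t \<omega> = z}"
    show "(INF m. grid_passage_time X z ((1/2) ^ m) \<omega>) \<le> ennreal t"
    proof (rule ennreal_le_epsilon)
      fix e :: real assume e: "0 < e"
      have "eventually (\<lambda>s. X s \<omega> = X t \<omega>) (at_right t)"
        using process \<omega> t unfolding markov_jump_process_def by blast
      then obtain b where b: "t < b" "\<And>s. t < s \<Longrightarrow> s < b \<Longrightarrow> X s \<omega> = z"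
        using t by (auto simp: eventually_at_right_field)
      \<comment> \<open>A step below \<open>d\<close> puts the first grid point strictly after \<open>t\<close> before \<open>b\<close>, where the
        path still sits at \<open>z\<close>, and at most \<open>e\<close> later than \<open>t\<close>.\<close>
      define d where "d = min (b - t) e"
      have d: "0 < d" using b(1) e by (simp add: d_def)
      then obtain m :: nat where m: "(1/2) ^ m < d"
        using real_arch_pow_inv[of d "1/2"] by auto
      define h where "h = (1/2 :: real) ^ m"
      have h: "0 < h" "h < d" using m by (simp_all add: h_def)
      define n where "n = nat (\<lfloor>t / h\<rfloor> + 1)"
      have "0 \<le> t / h" using t h by simp
      then have n: "real n = of_int \<lfloor>t / h\<rfloor> + 1"
        unfolding n_def by simp
      have "t / h < real n" "real n \<le> t / h + 1"
        unfolding n by linarith+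
      then have nh: "t < real n * h" "real n * h \<le> t + h"
        using h by (simp_all add: field_simps)
      have "X (real n * h) \<omega> = z"
        using nh h by (intro b(2)) (auto simp: d_def)
      then have "(INF m. grid_passage_time X z ((1/2) ^ m) \<omega>) \<le> ennreal (real n * h)"
        unfolding grid_passage_time_def h_def
        by (intro INF_lower2[of m] INF_lower) auto
      also have "\<dots> \<le> ennreal (t + e)"
        using nh h by (intro ennreal_leI) (auto simp: d_def)
      finally show "(INF m. grid_passage_time X z ((1/2) ^ m) \<omega>) \<le> ennreal t + ennreal e"
        using t e by simp
    qed
  qed
qed

text \<open>Halving the step only adds grid points.\<close>

lemma grid_passage_time_dyadic_decreasing:
  "decseq (\<lambda>m. grid_passage_time X z ((1/2) ^ m))"
proof (rule decseq_SucI, rule le_funI)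
  fix m \<omega>
  show "grid_passage_time X z ((1/2) ^ Suc m) \<omega> \<le> grid_passage_time X z ((1/2) ^ m) \<omega>"
    unfolding grid_passage_time_def
  proof (rule INF_greatest)
    fix n assume n: "n \<in> {n. X (real n * (1/2) ^ m) \<omega> = z}"
    have "real (2 * n) * (1/2) ^ Suc m = real n * (1/2) ^ m"
      by simp
    with n show "(INF n\<in>{n. X (real n * (1/2) ^ Suc m) \<omega> = z}. ennreal (real n * (1/2) ^ Suc m))
        \<le> ennreal (real n * (1/2) ^ m)"
      by (intro INF_lower2[of "2 * n"]) simp_all
  qed
qed

section \<open>Mean passage times solve the hitting equation\<close>

text \<open>A Lyapunov argument. If a nonnegative function vanishing at \<open>z\<close> loses between
  \<open>(1 - e) h\<close> and \<open>(1 + e) h\<close> on average in each grid step off \<open>z\<close>, then its mean along the killed chain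
  drops by that amount times the avoidance probability. Telescoping, the lower bound forces the
  avoidance probabilities to be summable, that is, the mean passage time to be finite. The killed mean
  then tends to \<open>0\<close>, so the total drop is the initial mean, which is therefore
  comparable with the mean passage time.\<close>

lemma mean_grid_passage_time_sandwich:
  fixes X :: "real \<Rightarrow> 'w \<Rightarrow> 'k::finite"
  assumes process: "markov_jump_process k M X" and h: "0 < h" and e: "e < 1"
    and g: "g z = 0" "\<And>x. 0 \<le> g x"
    and lower: "\<And>x. x \<noteq> z \<Longrightarrow> (1 - e) * h \<le> g x - markov_operator k h g x"
    and upper: "\<And>x. x \<noteq> z \<Longrightarrow> g x - markov_operator k h g x \<le> (1 + e) * h"
  obtains u where "(\<integral>\<^sup>+\<omega>. grid_passage_time X z h \<omega> \<partial>M) = ennreal u" "0 \<le> u"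
    "(1 - e) * u \<le> (\<Sum>y\<in>UNIV. measure M {\<omega> \<in> space M. X 0 \<omega> = y} * g y)"
    "(\<Sum>y\<in>UNIV. measure M {\<omega> \<in> space M. X 0 \<omega> = y} * g y) \<le> (1 + e) * u"
proof -
  interpret prob_space M
    using process by (simp add: markov_jump_process_def)
  define w where "w n = measure M (avoids M X z h n)" for n
  define a where "a n = avoiding_mean M X z h n g" for n
  have w_eq: "w n = avoiding_mean M X z h n (\<lambda>_. 1)" for n
    unfolding w_def using h by (intro measure_avoids[OF process]) simp
  have w_nonneg: "0 \<le> w n" for n
    by (simp add: w_def)
  have step: "a n - a (Suc n) = avoiding_mean M X z h n (\<lambda>x. g x - markov_operator k h g x)" for n
    using avoiding_mean_Suc[where g = g and z = z and n = n, OF process less_imp_le[OF h] g(1)]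
    by (simp add: a_def avoiding_mean_diff)
  have step_lower: "(1 - e) * h * w n \<le> a n - a (Suc n)" for n
    unfolding step w_eq avoiding_mean_const[symmetric]
    by (rule avoiding_mean_mono) (rule lower)
  have step_upper: "a n - a (Suc n) \<le> (1 + e) * h * w n" for n
    unfolding step w_eq avoiding_mean_const[symmetric]
    by (rule avoiding_mean_mono) (rule upper)
  have a_nonneg: "0 \<le> a n" for n
    unfolding a_def avoiding_mean_def by (intro sum_nonneg mult_nonneg_nonneg g) simp
  have telescope: "(\<Sum>i<n. a i - a (Suc i)) = a 0 - a n" for n
    by (simp add: sum_lessThan_telescope')
  have partial_lower: "(1 - e) * h * (\<Sum>i<n. w i) \<le> a 0" for n
  proof -
    have "(\<Sum>i<n. (1 - e) * h * w i) \<le> (\<Sum>i<n. a i - a (Suc i))"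
      by (intro sum_mono step_lower)
    then show ?thesis
      using a_nonneg[of n] by (simp add: telescope sum_distrib_left)
  qed
  have "(\<Sum>i<n. w i) \<le> a 0 / ((1 - e) * h)" for n
    using partial_lower[of n] e h by (simp add: pos_le_divide_eq mult.commute)
  then have summable: "summable w"
    by (intro summableI_nonneg_bounded w_nonneg)
  define u where "u = h * suminf w"
  have u_nonneg: "0 \<le> u"
    unfolding u_def using h summable w_nonneg by (simp add: suminf_nonneg)
  have sums: "(\<lambda>n. \<Sum>i<n. w i) \<longlonglongrightarrow> suminf w"
    using summable by (simp add: summable_LIMSEQ)
  have low: "(1 - e) * h * suminf w \<le> a 0"
    by (rule LIMSEQ_le_const2[OF tendsto_mult_left[OF sums]]) (use partial_lower in blast)
  have up: "a 0 \<le> (1 + e) * h * suminf w"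
  proof -
    define G where "G = (\<Sum>y\<in>UNIV. g y)"
    have "a n \<le> G * w n" for n
      unfolding a_def w_eq avoiding_mean_const[symmetric] G_def
      by (intro avoiding_mean_mono member_le_sum) (simp_all add: g)
    moreover have "(\<lambda>n. G * w n) \<longlonglongrightarrow> 0"
      using tendsto_mult_left[OF summable_LIMSEQ_zero[OF summable], of G] by simp
    ultimately have "a \<longlonglongrightarrow> 0"
      by (intro tendsto_sandwich[OF _ _ tendsto_const, of 0 a]) (simp_all add: a_nonneg)
    then have lim: "(\<lambda>n. a 0 - a n) \<longlonglongrightarrow> a 0 - 0"
      by (intro tendsto_diff tendsto_const)
    have le: "a 0 - a n \<le> (1 + e) * h * (\<Sum>i<n. w i)" for n
    proof -
      have "(\<Sum>i<n. a i - a (Suc i)) \<le> (\<Sum>i<n. (1 + e) * h * w i)"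
        by (intro sum_mono step_upper)
      then show ?thesis
        by (simp add: telescope sum_distrib_left)
    qed
    have "a 0 - 0 \<le> (1 + e) * h * suminf w"
      by (rule LIMSEQ_le[OF lim tendsto_mult_left[OF sums]]) (use le in blast)
    then show ?thesis by simp
  qed
  have integral: "(\<integral>\<^sup>+\<omega>. grid_passage_time X z h \<omega> \<partial>M) = ennreal u"
  proof -
    have avoids [measurable]: "avoids M X z h n \<in> sets M" for n
      using h by (intro avoids_sets[OF process]) simp
    have "(\<integral>\<^sup>+\<omega>. grid_passage_time X z h \<omega> \<partial>M)
        = (\<integral>\<^sup>+\<omega>. (\<Sum>n. ennreal h * indicator (avoids M X z h n) \<omega>) \<partial>M)"
      by (intro nn_integral_cong grid_passage_time_series h)
    also have "\<dots> = (\<Sum>n. ennreal h * emeasure M (avoids M X z h n))"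
      by (subst nn_integral_suminf, measurable) (intro suminf_cong nn_integral_cmult_indicator avoids)
    also have "\<dots> = (\<Sum>n. ennreal (h * w n))"
      using h by (intro suminf_cong) (simp add: w_def emeasure_eq_measure ennreal_mult)
    also have "\<dots> = ennreal (\<Sum>n. h * w n)"
      by (rule suminf_ennreal2) (use h summable w_nonneg in \<open>simp_all add: summable_mult\<close>)
    also have "\<dots> = ennreal u"
      using summable by (simp add: u_def suminf_mult)
    finally show ?thesis .
  qed
  have start: "a 0 = (\<Sum>y\<in>UNIV. measure M {\<omega> \<in> space M. X 0 \<omega> = y} * g y)"
    unfolding a_def using g(1) by (rule avoiding_mean_0)
  show ?thesis
  proof (rule that[OF integral u_nonneg])
    show "(1 - e) * u \<le> (\<Sum>y\<in>UNIV. measure M {\<omega> \<in> space M. X 0 \<omega> = y} * g y)"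
      using low by (simp add: u_def start mult.assoc)
    show "(\<Sum>y\<in>UNIV. measure M {\<omega> \<in> space M. X 0 \<omega> = y} * g y) \<le> (1 + e) * u"
      using up by (simp add: u_def start mult.assoc)
  qed
qed

lemma grid_passage_time_measurable:
  assumes process: "markov_jump_process k M X" and h: "0 < h"
  shows "grid_passage_time X z h \<in> borel_measurable M"
proof -
  have [measurable]: "avoids M X z h n \<in> sets M" for n
    using h by (intro avoids_sets[OF process]) simp
  have "(\<lambda>\<omega>. \<Sum>n. ennreal h * indicator (avoids M X z h n) \<omega>) \<in> borel_measurable M"
    by measurable
  then show ?thesis
    by (rule measurable_cong[THEN iffD2, rotated]) (rule grid_passage_time_series[OF h])
qed

lemma eventually_difference_quotient_bounds:
  fixes k :: "'k::finite \<Rightarrow> 'k \<Rightarrow> real"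
  assumes "0 < e" and g: "\<And>x. x \<noteq> z \<Longrightarrow> backward_generator k g x = -1"
  shows "eventually (\<lambda>h. \<forall>x. x \<noteq> z \<longrightarrow> (1 - e) * h \<le> g x - markov_operator k h g x \<and>
    g x - markov_operator k h g x \<le> (1 + e) * h) (at_right 0)"
proof (rule eventually_all_finite)
  fix x
  show "eventually (\<lambda>h. x \<noteq> z \<longrightarrow> (1 - e) * h \<le> g x - markov_operator k h g x \<and>
    g x - markov_operator k h g x \<le> (1 + e) * h) (at_right 0)"
  proof (cases "x = z")
    case False
    have "((\<lambda>h. (markov_operator k h g x - g x) / h) \<longlongrightarrow> -1) (at_right 0)"
      using semigroup_difference_quotient[of k g x] g[OF False]
      by (auto intro: filterlim_at_split[THEN iffD1, THEN conjunct2])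
    then have "eventually (\<lambda>h. dist ((markov_operator k h g x - g x) / h) (-1) < e) (at_right 0)"
      using \<open>0 < e\<close> by (rule tendstoD)
    moreover have "eventually (\<lambda>h::real. 0 < h) (at_right 0)"
      by (rule eventually_at_right_less)
    ultimately show ?thesis
    proof eventually_elim
      case (elim h)
      define q where "q = (markov_operator k h g x - g x) / h"
      have "markov_operator k h g x - g x = q * h"
        using elim by (simp add: q_def)
      moreover have "- 1 - e \<le> q" "q \<le> - 1 + e"
        using elim by (auto simp: q_def[symmetric] dist_real_def)
      then have "(- 1 - e) * h \<le> q * h" "q * h \<le> (- 1 + e) * h"
        using elim by (simp_all add: mult_right_mono)
      ultimately show ?case
        by (simp add: algebra_simps)
    qed
  qed simp
qed

text \<open>A solution of the hitting equation satisfies the hypotheses of the sandwich for every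
  \<open>e\<close> strictly between \<open>0\<close> and \<open>1\<close> once the grid is fine, as there are only finitely many states. Monotone convergence along the
  dyadic grids carries the sandwich to the continuous-time mean, and then \<open>e\<close> tends to \<open>0\<close>.\<close>

lemma mean_first_passage_time_eq:
  fixes X :: "real \<Rightarrow> 'w \<Rightarrow> 'k::finite"
  assumes process: "markov_jump_process k M X"
    and g: "g z = 0" "\<And>x. 0 \<le> g x" "\<And>x. x \<noteq> z \<Longrightarrow> backward_generator k g x = -1"
  shows "(\<integral>\<^sup>+\<omega>. first_passage_time X z \<omega> \<partial>M)
    = ennreal (\<Sum>y\<in>UNIV. measure M {\<omega> \<in> space M. X 0 \<omega> = y} * g y)"
proof -
  define c where "c = (\<Sum>y\<in>UNIV. measure M {\<omega> \<in> space M. X 0 \<omega> = y} * g y)"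
  define T where "T m = grid_passage_time X z ((1/2) ^ m)" for m
  define I where "I m = (\<integral>\<^sup>+\<omega>. T m \<omega> \<partial>M)" for m
  define L where "L = (\<integral>\<^sup>+\<omega>. first_passage_time X z \<omega> \<partial>M)"
  have near: "eventually (\<lambda>m. \<exists>u. I m = ennreal u \<and> 0 \<le> u \<and> (1 - e) * u \<le> c \<and> c \<le> (1 + e) * u)
      sequentially" if e: "0 < e" "e < 1" for e
  proof -
    have "filterlim (\<lambda>m. (1/2 :: real) ^ m) (at_right 0) sequentially"
      by (intro tendsto_imp_filterlim_at_right LIMSEQ_power_zero) simp_all
    moreover have "eventually (\<lambda>h. \<forall>x. x \<noteq> z \<longrightarrow> (1 - e) * h \<le> g x - markov_operator k h g x \<and>
        g x - markov_operator k h g x \<le> (1 + e) * h) (at_right 0)"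
      using e(1) g(3) by (rule eventually_difference_quotient_bounds)
    ultimately have "eventually (\<lambda>m. \<forall>x. x \<noteq> z \<longrightarrow>
        (1 - e) * (1/2) ^ m \<le> g x - markov_operator k ((1/2) ^ m) g x \<and>
        g x - markov_operator k ((1/2) ^ m) g x \<le> (1 + e) * (1/2) ^ m) sequentially"
      by (rule eventually_compose_filterlim[rotated])
    then show ?thesis
    proof eventually_elim
      case (elim m)
      show ?case
        by (rule mean_grid_passage_time_sandwich[OF process, of "(1/2) ^ m" e g z])
          (use elim e g in \<open>auto simp: I_def T_def c_def\<close>)
    qed
  qed
  have T_dec: "decseq T"
    unfolding T_def by (rule grid_passage_time_dyadic_decreasing)
  have T_meas: "T m \<in> borel_measurable M" for m
    unfolding T_def by (intro grid_passage_time_measurable[OF process]) simp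
  have I_dec: "decseq I"
    unfolding I_def
    by (intro decseq_SucI nn_integral_mono le_funD[OF decseq_SucD[OF T_dec]])
  obtain m0 where m0: "I m0 < \<infinity>"
    using eventually_happens'[OF sequentially_bot near[of "1/2"]]
    by (fastforce simp: less_top[symmetric])
  have "L = (\<integral>\<^sup>+\<omega>. (INF m. T m \<omega>) \<partial>M)"
    unfolding L_def T_def
    by (intro nn_integral_cong first_passage_time_dyadic[OF process])
  also have "\<dots> = (INF m. I m)"
    unfolding I_def using m0[unfolded I_def]
    by (intro nn_integral_monotone_convergence_INF_decseq T_dec T_meas)
  finally have L: "L = (INF m. I m)" .
  then have lim: "I \<longlonglongrightarrow> L"
    using LIMSEQ_INF[OF I_dec] by simp
  have "L < \<infinity>"
    unfolding L using m0 by (rule INF_lower[THEN le_less_trans, rotated]) simp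
  then obtain l where l: "L = ennreal l" "0 \<le> l"
    by (cases L) auto
  have bounds: "(1 - e) * l \<le> c \<and> c \<le> (1 + e) * l" if e: "0 < e" "e < 1" for e
  proof -
    define u where "u m = enn2real (I m)" for m
    have u_lim: "u \<longlonglongrightarrow> l"
      using tendsto_enn2real[of I l] lim l unfolding u_def by simp
    have "eventually (\<lambda>m. (1 - e) * u m \<le> c \<and> c \<le> (1 + e) * u m) sequentially"
      using near[OF e] by eventually_elim (auto simp: u_def)
    then show ?thesis
      using tendsto_upperbound[OF tendsto_mult_left[OF u_lim, of "1 - e"], of c]
        tendsto_lowerbound[OF tendsto_mult_left[OF u_lim, of "1 + e"], of c]
      by (auto simp: eventually_conj_iff)
  qed
  have small: "eventually (\<lambda>e::real. 0 < e \<and> e < 1) (at_right 0)"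
    by (auto simp: eventually_at_right_field intro!: exI[of _ 1])
  have "l \<le> c"
  proof (rule tendsto_upperbound)
    show "((\<lambda>e. (1 - e) * l) \<longlongrightarrow> l) (at_right 0)"
      by (auto intro!: tendsto_eq_intros)
    show "eventually (\<lambda>e. (1 - e) * l \<le> c) (at_right 0)"
      using small by eventually_elim (use bounds in blast)
  qed simp
  moreover have "c \<le> l"
  proof (rule tendsto_lowerbound)
    show "((\<lambda>e. (1 + e) * l) \<longlongrightarrow> l) (at_right 0)"
      by (auto intro!: tendsto_eq_intros)
    show "eventually (\<lambda>e. c \<le> (1 + e) * l) (at_right 0)"
      using small by eventually_elim (use bounds in blast)
  qed simp
  ultimately show ?thesis
    using l by (simp add: L_def c_def)
qed

lemma mean_first_passage_time_from_state:
  fixes X :: "real \<Rightarrow> 'w \<Rightarrow> 'k::finite"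
  assumes process: "markov_jump_process k (P x) X" and start: "AE \<omega> in P x. X 0 \<omega> = x"
    and g: "g z = 0" "\<And>x. 0 \<le> g x" "\<And>x. x \<noteq> z \<Longrightarrow> backward_generator k g x = -1"
  shows "mean_first_passage_time P X x z = ennreal (g x)"
proof -
  interpret prob_space "P x"
    using process by (simp add: markov_jump_process_def)
  have [measurable]: "X 0 \<in> measurable (P x) (count_space UNIV)"
    using process by (simp add: markov_jump_process_def)
  have "measure (P x) {\<omega> \<in> space (P x). X 0 \<omega> = y} = indicat_real {y} x" for y
  proof (cases "y = x")
    case True
    then show ?thesis
      using start by (simp add: prob_Collect_eq_1)
  next
    case False
    then have "AE \<omega> in P x. X 0 \<omega> \<noteq> y"
      using start by auto
    then show ?thesis
      using False by (simp add: prob_Collect_eq_0)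
  qed
  then show ?thesis
    using mean_first_passage_time_eq[OF process g] sum_indicator_basis[of g x]
    by (simp add: mean_first_passage_time_def mult.commute)
qed

section \<open>The solution of the Poisson equation\<close>

text \<open>The hitting equation leaves \<open>L g z\<close> at the target itself undetermined. Integrating
  against the stationary distribution, for which \<open>L g\<close> has mean \<open>0\<close>, determines it: this is Kac's formula
  \<open>L g z + 1 = 1 / \<rho> z\<close>, in a form without division.\<close>

lemma stationary_mass_hitting:
  fixes k :: "'k::finite \<Rightarrow> 'k \<Rightarrow> real"
  assumes stat: "stationary_distribution k \<rho>"
    and g: "\<And>x. x \<noteq> z \<Longrightarrow> backward_generator k g x = -1"
  shows "\<rho> z * (backward_generator k g z + 1) = 1"
proof -
  have "(\<Sum>x\<in>UNIV. \<rho> x * (backward_generator k g x + 1)) = 1"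
    using stationary_generator_zero[OF stat, of g] stat
    by (simp add: distrib_left sum.distrib stationary_distribution_def)
  moreover have "(\<Sum>x\<in>UNIV. \<rho> x * (backward_generator k g x + 1))
      = \<rho> z * (backward_generator k g z + 1) + (\<Sum>x\<in>UNIV - {z}. \<rho> x * (backward_generator k g x + 1))"
    by (rule sum.remove) simp_all
  moreover have "(\<Sum>x\<in>UNIV - {z}. \<rho> x * (backward_generator k g x + 1)) = 0"
    by (rule sum.neutral) (simp add: g)
  ultimately show ?thesis by simp
qed

theorem mainTheorem6:
  fixes k :: "'k::finite \<Rightarrow> 'k \<Rightarrow> real"
    and P :: "'k \<Rightarrow> 'w measure"
    and X :: "real \<Rightarrow> 'w \<Rightarrow> 'k"
    and \<rho> f V :: "'k \<Rightarrow> real"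
  defines "\<tau> \<equiv> mean_first_passage_time P X"
  assumes rates_nonneg: "\<And>x y. x \<noteq> y \<Longrightarrow> k x y \<ge> 0"
    and irreducible: "irreducible_rates k"
    and process: "\<And>x. markov_jump_process k (P x) X"
    and start: "\<And>x. AE \<omega> in P x. X 0 \<omega> = x"
    and stationary: "stationary_distribution k \<rho>"
    and centered: "(\<Sum>x\<in>UNIV. \<rho> x * f x) = 0"
    and poisson: "\<And>x. backward_generator k V x + f x = 0"
  shows "(\<forall>x z. \<tau> x z < \<infinity>) \<and>
    (\<forall>V'. (\<forall>x. backward_generator k V' x + f x = 0) \<longrightarrow> (\<exists>d. \<forall>x. V' x = V x + d)) \<and>
    (\<exists>c. \<forall>x. V x = - (\<Sum>z\<in>UNIV. \<rho> z * f z * enn2real (\<tau> x z)) + c) \<and>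
    (\<exists>!c. (\<Sum>x\<in>UNIV. \<rho> x * (- (\<Sum>z\<in>UNIV. \<rho> z * f z * enn2real (\<tau> x z)) + c)) = 0)"
proof -
  have "\<exists>g. g z = 0 \<and> (\<forall>x. 0 \<le> g x) \<and> (\<forall>x. x \<noteq> z \<longrightarrow> backward_generator k g x = -1)" for z
    by (rule hitting_equation_solvable[OF rates_nonneg irreducible, of z]) blast+
  then obtain g where g: "\<And>z. g z z = 0" "\<And>z x. 0 \<le> g z x"
      "\<And>z x. x \<noteq> z \<Longrightarrow> backward_generator k (g z) x = -1"
    by metis
  have tau: "\<tau> x z = ennreal (g z x)" for x z
    unfolding \<tau>_def using process start g by (rule mean_first_passage_time_from_state)
  have mass: "\<rho> z * (backward_generator k (g z) z + 1) = 1" for z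
    using stationary g(3) by (rule stationary_mass_hitting)
  have unique: "\<exists>d. \<forall>x. W x = V x + d" if W: "\<And>x. backward_generator k W x + f x = 0" for W
  proof -
    define D where "D x = 1 * W x + (- 1) * V x" for x
    have "backward_generator k D x = 0" for x
      unfolding D_def generator_linear using W[of x] poisson[of x] by simp
    \<comment> \<open>Any state serves as the reference point.\<close>
    then have "D x = D undefined" for x
      using harmonic_constant[of k D x undefined] rates_nonneg irreducible by blast
    moreover have "W x = V x + D x" for x
      by (simp add: D_def)
    ultimately have "W x = V x + D undefined" for x
      by metis
    then show ?thesis by blast
  qed
  define U where "U x = - (\<Sum>z\<in>UNIV. \<rho> z * f z * enn2real (\<tau> x z))" for x
  have U: "U x = (\<Sum>z\<in>UNIV. (- \<rho> z * f z) * g z x)" for x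
    by (simp add: U_def tau g sum_negf)
  have "backward_generator k U x + f x = 0" for x
  proof -
    have "backward_generator k U x = (\<Sum>z\<in>UNIV. (- \<rho> z * f z) * backward_generator k (g z) x)"
      unfolding U generator_sum ..
    \<comment> \<open>For \<open>z \<noteq> x\<close> the term is \<open>\<rho> z * f z\<close>, by Kac's formula \<open>- f x\<close> is
      added to it for \<open>z = x\<close>, and the \<open>\<rho> z * f z\<close> sum to zero.\<close>
    also have "\<dots> = (\<Sum>z\<in>UNIV. \<rho> z * f z - f z * indicat_real {z} x)"
    proof (intro sum.cong refl)
      fix z
      show "(- \<rho> z * f z) * backward_generator k (g z) x = \<rho> z * f z - f z * indicat_real {z} x"
      proof (cases "x = z")
        case True
        have "(- \<rho> z * f z) * backward_generator k (g z) z
            = \<rho> z * f z - f z * (\<rho> z * (backward_generator k (g z) z + 1))"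
          by (simp add: algebra_simps)
        then show ?thesis
          using True by (simp add: mass)
      qed (simp add: g)
    qed
    also have "\<dots> = - f x"
      by (simp add: sum_subtractf centered sum_indicator_basis)
    finally show ?thesis by simp
  qed
  then obtain d where "\<And>x. U x = V x + d"
    using unique[of U] by blast
  then have "\<forall>x. V x = U x + (- d)"
    by simp
  moreover have "\<exists>!c. (\<Sum>x\<in>UNIV. \<rho> x * (U x + c)) = 0"
  proof -
    have "(\<Sum>x\<in>UNIV. \<rho> x * (U x + c)) = (\<Sum>x\<in>UNIV. \<rho> x * U x) + c" for c
      using stationary
      by (simp add: distrib_left sum.distrib sum_distrib_right[symmetric] stationary_distribution_def)
    then show ?thesis
      by (auto intro!: ex1I[of _ "- (\<Sum>x\<in>UNIV. \<rho> x * U x)"])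
  qed
  ultimately show ?thesis
    using unique unfolding U_def[symmetric] by (auto simp: tau)
qed

end
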